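(* Let $k$ be an algebraically closed field of characteristic zero. Let $G$ be a non-Abelian finite group which is not isomorphic to a dihedral group and which admits a faithful linear representation $\lambda\colon G\hookrightarrow\mathrm{GL}_2(k)$. Then every (faithful) rational action of the group $G$ on $\mathbf A^2$ is obtained by means of a nontrivial base change from its linear action $\lambda$ on $\mathbf A^2$.
   Context: A (faithful) rational action of $G$ on an irreducible algebraic variety $X$ over $k$ is an injective homomorphism $\varrho\colon G\hookrightarrow\mathrm{Bir}(X)$. A rational action $\varrho_1\colon G\hookrightarrow\mathrm{Bir}(X_1)$ is obtained by a nontrivial base change from a rational action $\varrho_2\colon G\hookrightarrow\mathrm{Bir}(X_2)$ if there is a $G$-equivariant dominant rational map $X_1\dashrightarrow X_2$ which is not a birational isomorphism. *)

theory Defs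
  imports
    "HOL-Algebra.Group"
    "HOL-Analysis.Cartesian_Space"
    "HOL-Computational_Algebra.Fraction_Field"
    "HOL-Computational_Algebra.Polynomial"
begin

section \<open>Polynomials and rational functions on the affine plane\<close>

text \<open>Points of the plane over \<open>k\<close> are elements of \<open>k ^ 2\<close>.  The coordinate ring \<open>k[x, y]\<close> is
  represented as \<open>k[x][y]\<close>: the outer variable is the second coordinate.  Since \<open>k\<close> will be
  algebraically closed, identifying the plane with its set of \<open>k\<close>-points is harmless.\<close>

type_synonym 'k ratfun = "'k poly poly fract"

definition eval_poly2 :: "'k::field poly poly \<Rightarrow> 'k ^ 2 \<Rightarrow> 'k" where
  "eval_poly2 p P = poly (poly p [:P $ 2:]) (P $ 1)"

definition zariski_closed :: "('k::field ^ 2) set \<Rightarrow> bool" where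
  "zariski_closed Z \<longleftrightarrow> (\<exists>S. Z = {P. \<forall>p\<in>S. eval_poly2 p P = 0})"

definition zariski_dense :: "('k::field ^ 2) set \<Rightarrow> bool" where
  "zariski_dense A \<longleftrightarrow> (\<forall>Z. zariski_closed Z \<and> A \<subseteq> Z \<longrightarrow> Z = UNIV)"

definition regular_at :: "'k::field ratfun \<Rightarrow> 'k ^ 2 \<Rightarrow> bool" where
  "regular_at f P \<longleftrightarrow> (\<exists>p q. f = Fraction_Field.Fract p q \<and> eval_poly2 q P \<noteq> 0)"

text \<open>The value does not depend on the chosen fraction; it is meaningful only where the
  function is regular.\<close>

definition ratfun_value :: "'k::field ratfun \<Rightarrow> 'k ^ 2 \<Rightarrow> 'k" where
  "ratfun_value f P = (THE v. \<exists>p q. f = Fraction_Field.Fract p q \<and> eval_poly2 q P \<noteq> 0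
     \<and> v = eval_poly2 p P / eval_poly2 q P)"


section \<open>Rational self-maps of the plane\<close>

text \<open>A rational map from the plane to itself is a pair of rational functions.\<close>

type_synonym 'k ratmap = "'k ratfun ^ 2"

definition ratmap_dom :: "'k::field ratmap \<Rightarrow> ('k ^ 2) set" where
  "ratmap_dom \<phi> = {P. \<forall>i. regular_at (\<phi> $ i) P}"

definition ratmap_value :: "'k::field ratmap \<Rightarrow> 'k ^ 2 \<Rightarrow> 'k ^ 2" where
  "ratmap_value \<phi> P = (\<chi> i. ratfun_value (\<phi> $ i) P)"

definition dominant :: "'k::field ratmap \<Rightarrow> bool" where
  "dominant \<phi> \<longleftrightarrow> zariski_dense (ratmap_value \<phi> ` ratmap_dom \<phi>)"

text \<open>The composite of \<open>\<psi>\<close> after \<open>\<phi>\<close> is the rational map that agrees with the pointwise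
  composite wherever the latter is defined.  If \<open>\<phi>\<close> is dominant and \<open>k\<close> is infinite, that locus is
  a nonempty Zariski-open set and the description determines the composite uniquely; the
  composite is only used for dominant \<open>\<phi>\<close>.\<close>

definition ratmap_comp :: "'k::field ratmap \<Rightarrow> 'k ratmap \<Rightarrow> 'k ratmap" where
  "ratmap_comp \<psi> \<phi> = (THE \<theta>. \<forall>P\<in>ratmap_dom \<phi>. ratmap_value \<phi> P \<in> ratmap_dom \<psi> \<longrightarrow>
     P \<in> ratmap_dom \<theta> \<and> ratmap_value \<theta> P = ratmap_value \<psi> (ratmap_value \<phi> P))"

definition coord :: "'k::field ratmap" where
  "coord = vector [Fraction_Field.Fract [:[:0, 1:]:] 1, Fraction_Field.Fract [:0, 1:] 1]"

definition const_ratfun :: "'k::field \<Rightarrow> 'k ratfun" where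
  "const_ratfun c = Fraction_Field.Fract [:[:c:]:] 1"

text \<open>The group of birational self-maps of the plane; the identity map is the pair of
  coordinate functions.\<close>

definition Bir :: "'k::field ratmap monoid" where
  "Bir = \<lparr>carrier = {\<phi>. dominant \<phi> \<and>
            (\<exists>\<psi>. dominant \<psi> \<and> ratmap_comp \<psi> \<phi> = coord \<and> ratmap_comp \<phi> \<psi> = coord)},
          monoid.mult = ratmap_comp, one = coord\<rparr>"


section \<open>Rational and linear actions\<close>

definition rational_action :: "('g, 'm) monoid_scheme \<Rightarrow> ('g \<Rightarrow> 'k::field ratmap) \<Rightarrow> bool" where
  "rational_action G \<rho> \<longleftrightarrow> \<rho> \<in> mon G Bir"

definition nontrivial_base_change ::
  "('g, 'm) monoid_scheme \<Rightarrow> ('g \<Rightarrow> 'k::field ratmap) \<Rightarrow> ('g \<Rightarrow> 'k ratmap) \<Rightarrow> bool" where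
  "nontrivial_base_change G \<rho>\<^sub>1 \<rho>\<^sub>2 \<longleftrightarrow> rational_action G \<rho>\<^sub>1 \<and> rational_action G \<rho>\<^sub>2 \<and>
     (\<exists>\<tau>. dominant \<tau> \<and>
       (\<forall>g\<in>carrier G. ratmap_comp \<tau> (\<rho>\<^sub>1 g) = ratmap_comp (\<rho>\<^sub>2 g) \<tau>) \<and>
       \<tau> \<notin> carrier Bir)"

definition GL2 :: "('k::field ^ 2 ^ 2) monoid" where
  "GL2 = \<lparr>carrier = {A. invertible A}, monoid.mult = (**), one = mat 1\<rparr>"

text \<open>The map \<open>v \<mapsto> A v\<close> of the plane.\<close>

definition linear_ratmap :: "'k::field ^ 2 ^ 2 \<Rightarrow> 'k ratmap" where
  "linear_ratmap A = (\<chi> i j. const_ratfun (A $ i $ j)) *v coord"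


section \<open>Dihedral groups\<close>

text \<open>The dihedral group of order \<open>2 n\<close>, for \<open>n \<ge> 1\<close>: the pair \<open>(a, s)\<close> stands for \<open>r\<^sup>a\<close> if \<open>s\<close> is
  false and for \<open>r\<^sup>a t\<close> if \<open>s\<close> is true, where \<open>r\<^sup>n = t\<^sup>2 = 1\<close> and \<open>t r t = r\<^sup>-\<^sup>1\<close>.\<close>

definition dihedral_group :: "nat \<Rightarrow> (int \<times> bool) monoid" where
  "dihedral_group n = \<lparr>carrier = {0..<int n} \<times> UNIV,
     monoid.mult = (\<lambda>(a, s) (b, t). ((if s then a - b else a + b) mod int n, s \<noteq> t)),
     one = (0, False)\<rparr>"

end

theory Submission
  imports Defs "HOL-Analysis.Determinants"
begin

text \<open>
  Let \<open>K = k(x, y)\<close>, on which \<open>G\<close> acts through \<open>\<rho>\<close>. Averaging an element of \<open>K\<close> against \<open>\<lambda>\<close> gives an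
  equivariant pair \<open>v = (v\<^sub>1, v\<^sub>2)\<close>, which by Dedekind's independence of characters can be taken
  nonzero. As \<open>G\<close> is not Abelian, \<open>v\<^sub>1\<close> and \<open>v\<^sub>2\<close> are linearly independent over \<open>k\<close>, so \<open>t = v\<^sub>1 / v\<^sub>2\<close> is
  not constant. The Jacobian derivation \<open>J(t, _)\<close> is then nonzero and cannot vanish on all
  invariants, since \<open>K\<close> is algebraic over them; hence \<open>J(t, a v\<^sub>2) \<noteq> 0\<close> for some invariant \<open>a\<close>, and
  \<open>w = a v\<close> is an equivariant dominant map.

  Such a \<open>w\<close> may be birational. It is therefore composed with the equivariant map
  \<open>m(p) = h(p) p\<close>, where \<open>h\<close> is the product over \<open>G\<close> of the translates of the first coordinate.
  Since \<open>h\<close> is homogeneous of degree \<open>|G|\<close>, \<open>m\<close> is unchanged when \<open>p\<close> is multiplied by a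
  \<open>(|G| + 1)\<close>-th root of unity, so \<open>m \<circ> w\<close> is not birational.
\<close>

section \<open>Ring homomorphisms and their extension to polynomials and fractions\<close>

locale unital_hom =
  fixes h :: "'a::comm_ring_1 \<Rightarrow> 'b::comm_ring_1"
  assumes one: "h 1 = 1"
    and add: "h (x + y) = h x + h y"
    and mult: "h (x * y) = h x * h y"
begin

lemma zero: "h 0 = 0"
  using add[of 0 0] by simp

lemma uminus: "h (- x) = - h x"
  using add[of x "- x"] by (simp add: zero minus_unique)

lemma diff: "h (x - y) = h x - h y"
  using add[of x "- y"] by (simp add: uminus)

lemma sum: "h (\<Sum>i\<in>A. f i) = (\<Sum>i\<in>A. h (f i))"
  by (induction A rule: infinite_finite_induct) (auto simp: zero add)

lemma prod: "h (\<Prod>i\<in>A. f i) = (\<Prod>i\<in>A. h (f i))"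
  by (induction A rule: infinite_finite_induct) (auto simp: one mult)

lemma poly_map_poly_pCons:
  "poly (map_poly h (pCons a p)) s = h a + s * poly (map_poly h p) s"
  by (cases "a = 0 \<and> p = 0") (auto simp: map_poly_pCons zero)

lemma map_poly_add: "map_poly h (p + q) = map_poly h p + map_poly h q"
  by (intro poly_eqI) (simp add: coeff_map_poly zero add)

lemma map_poly_mult: "map_poly h (p * q) = map_poly h p * map_poly h q"
  by (intro poly_eqI) (simp add: coeff_map_poly zero coeff_mult sum mult)

lemma map_poly_prod: "map_poly h (\<Prod>i\<in>A. f i) = (\<Prod>i\<in>A. map_poly h (f i))"
  by (induction A rule: infinite_finite_induct) (auto simp: one map_poly_mult)

text \<open>Used twice, once for each variable of \<open>k[x][y]\<close>, this makes substitution a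
  ring homomorphism.\<close>

lemma unital_hom_poly: "unital_hom (\<lambda>p. poly (map_poly h p) s)"
  by unfold_locales (simp_all add: map_poly_add map_poly_mult one)

end

locale field_hom = unital_hom h for h :: "'a::field \<Rightarrow> 'b::field"
begin

lemma eq_0_iff: "h x = 0 \<longleftrightarrow> x = 0"
proof
  assume "h x = 0"
  hence "h (x * inverse x) = 0" by (simp add: mult)
  thus "x = 0" using one by (cases "x = 0") auto
qed (simp add: zero)

lemma eq_iff: "h x = h y \<longleftrightarrow> x = y"
  using eq_0_iff[of "x - y"] by (simp add: diff)

lemma divide: "h (x / y) = h x / h y"
proof (cases "y = 0")
  case False
  hence "h (x / y) * h y = h x" by (simp flip: mult)
  thus ?thesis using False by (simp add: field_simps eq_0_iff)
qed (simp add: zero)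

end

definition fract_ext :: "('a::idom \<Rightarrow> 'b::field) \<Rightarrow> 'a fract \<Rightarrow> 'b" where
  "fract_ext h f = (THE r. \<exists>p q. q \<noteq> 0 \<and> f = Fract p q \<and> r = h p / h q)"

context
  fixes h :: "'a::idom \<Rightarrow> 'b::field"
  assumes hom: "unital_hom h" and inj: "\<And>p. h p = 0 \<Longrightarrow> p = 0"
begin

text \<open>\<open>h\<close> preserves the cross-multiplied equality of two fractions, and
  injectivity keeps the denominators nonzero.\<close>

lemma fract_ext_Fract:
  assumes "q \<noteq> 0"
  shows "fract_ext h (Fract p q) = h p / h q"
  unfolding fract_ext_def
proof (rule the_equality)
  interpret unital_hom h by (rule hom)
  fix r assume "\<exists>p' q'. q' \<noteq> 0 \<and> Fract p q = Fract p' q' \<and> r = h p' / h q'"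
  then obtain p' q' where *: "q' \<noteq> 0" "Fract p q = Fract p' q'" "r = h p' / h q'" by blast
  hence "p * q' = p' * q" using assms by (simp add: eq_fract)
  hence "h p * h q' = h p' * h q" by (metis mult)
  moreover have "h q \<noteq> 0" "h q' \<noteq> 0" using assms * inj by blast+
  ultimately show "r = h p / h q" using * by (simp add: frac_eq_eq)
qed (use assms in blast)

lemma field_hom_fract_ext: "field_hom (fract_ext h)"
proof -
  interpret unital_hom h by (rule hom)
  show ?thesis
  proof unfold_locales
    show "fract_ext h 1 = 1" by (simp add: One_fract_def fract_ext_Fract one)
  next
    fix x y :: "'a fract"
    obtain a b where x: "x = Fract a b" "b \<noteq> 0" by (cases x)
    obtain c d where y: "y = Fract c d" "d \<noteq> 0" by (cases y)
    have nz: "h b \<noteq> 0" "h d \<noteq> 0" using x y inj by auto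
    show "fract_ext h (x + y) = fract_ext h x + fract_ext h y"
      using x y nz by (simp add: fract_ext_Fract add mult field_simps)
    show "fract_ext h (x * y) = fract_ext h x * fract_ext h y"
      using x y nz by (simp add: fract_ext_Fract mult)
  qed
qed

end

section \<open>Derivations of integral domains and of their fraction fields\<close>

locale derivation =
  fixes D :: "'a::idom \<Rightarrow> 'a"
  assumes add: "D (x + y) = D x + D y"
    and mult: "D (x * y) = D x * y + x * D y"
begin

lemma zero: "D 0 = 0"
  using add[of 0 0] by (metis add.right_neutral add_left_cancel)

lemma one: "D 1 = 0"
  using mult[of 1 1] by (metis add.right_neutral add_left_cancel mult_1 mult_1_right)

lemma sum: "D (\<Sum>i\<in>A. f i) = (\<Sum>i\<in>A. D (f i))"
  by (induction A rule: infinite_finite_induct) (auto simp: zero add)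

lemma power_Suc: "D (x ^ Suc n) = of_nat (Suc n) * x ^ n * D x"
  by (induction n) (simp_all add: mult one algebra_simps)

lemma prod_eq_0: "(\<And>i. i \<in> A \<Longrightarrow> D (f i) = 0) \<Longrightarrow> D (\<Prod>i\<in>A. f i) = 0"
  by (induction A rule: infinite_finite_induct) (auto simp: one mult)

lemma poly:
  assumes "\<And>i. D (coeff p i) = 0"
  shows "D (poly p s) = poly (pderiv p) s * D s"
  using assms
proof (induction p)
  case (pCons a p)
  have "D (coeff p i) = 0" for i using pCons.prems[of "Suc i"] by simp
  moreover have "D a = 0" using pCons.prems[of 0] by simp
  ultimately show ?case using pCons.IH
    by (simp add: pderiv_pCons add mult algebra_simps)
qed (simp add: zero)

text \<open>In \<open>k[x][y]\<close> the inner variable is \<open>x\<close>, so the partial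
  derivative in \<open>x\<close> has this form.\<close>

lemma derivation_map_poly: "derivation (map_poly D)"
proof
  fix p q :: "'a poly"
  show "map_poly D (p + q) = map_poly D p + map_poly D q"
    by (intro poly_eqI) (simp add: coeff_map_poly zero add)
  show "map_poly D (p * q) = map_poly D p * q + p * map_poly D q"
    by (intro poly_eqI) (simp add: coeff_map_poly zero coeff_mult sum mult sum.distrib)
qed

end

lemma derivation_pderiv: "derivation (pderiv :: 'a::idom poly \<Rightarrow> _)"
  by unfold_locales (simp_all add: pderiv_add pderiv_mult mult.commute add.commute)

text \<open>By the chain rule, \<open>D s \<noteq> 0\<close> would make \<open>s\<close> a root of
  \<open>pderiv p\<close>. In characteristic zero this is again nonzero, of smaller degree and with
  coefficients killed by \<open>D\<close>, so the descent never ends.\<close>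

lemma derivation_algebraic:
  fixes D :: "'a::{idom,semiring_char_0} \<Rightarrow> 'a"
  assumes D: "derivation D" and p: "p \<noteq> 0" "\<And>i. D (coeff p i) = 0" "poly p s = 0"
  shows "D s = 0"
  using p
proof (induction "degree p" arbitrary: p rule: less_induct)
  case less
  interpret derivation D by (rule D)
  show ?case
  proof (rule ccontr)
    assume s: "D s \<noteq> 0"
    have "poly (pderiv p) s * D s = 0"
      using poly[OF less.prems(2), of s] less.prems(3) by (simp add: zero)
    with s have root: "poly (pderiv p) s = 0" by simp
    have pos: "degree p > 0"
    proof (rule ccontr)
      assume "\<not> degree p > 0"
      then obtain c where "p = [:c:]" by (auto elim: degree_eq_zeroE)
      with less.prems show False by simp
    qed
    have "D (of_nat n * c) = of_nat n * D c" for n c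
      by (induction n) (auto simp: zero add algebra_simps)
    hence "D (coeff (pderiv p) i) = 0" for i
      using less.prems(2) by (metis coeff_pderiv mult_zero_right)
    moreover have "pderiv p \<noteq> 0" using pos by (simp add: pderiv_eq_0_iff)
    moreover have "degree (pderiv p) < degree p" using pos by (simp add: degree_pderiv)
    ultimately show False using less.hyps root s by blast
  qed
qed

text \<open>Lets \<open>derivation_algebraic\<close> be applied in the function field.\<close>

instance fract :: ("{idom,ring_char_0}") ring_char_0
proof
  show "inj (of_nat :: nat \<Rightarrow> 'a fract)"
    by (auto intro!: injI simp: of_nat_fract eq_fract)
qed

definition fract_deriv :: "('a::idom \<Rightarrow> 'a) \<Rightarrow> 'a fract \<Rightarrow> 'a fract" where
  "fract_deriv d f = (THE r. \<exists>p q. q \<noteq> 0 \<and> f = Fract p q \<and> r = Fract (d p * q - p * d q) (q * q))"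

text \<open>Applying \<open>d\<close> to the cross-multiplied equality of two fractions shows that
  the quotient rule gives the same result for both.\<close>

lemma fract_deriv_Fract:
  assumes "derivation d" "q \<noteq> 0"
  shows "fract_deriv d (Fract p q) = Fract (d p * q - p * d q) (q * q)"
  unfolding fract_deriv_def
proof (rule the_equality)
  interpret derivation d by fact
  fix r assume "\<exists>p' q'. q' \<noteq> 0 \<and> Fract p q = Fract p' q' \<and> r = Fract (d p' * q' - p' * d q') (q' * q')"
  then obtain p' q' where *: "q' \<noteq> 0" "Fract p q = Fract p' q'"
      "r = Fract (d p' * q' - p' * d q') (q' * q')" by blast
  hence e: "p * q' = p' * q" using assms by (simp add: eq_fract)
  hence "d p * q' + p * d q' = d p' * q + p' * d q" by (metis mult)
  hence "(d p' * q' - p' * d q') * (q * q) = (d p * q - p * d q) * (q' * q')"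
    using e by algebra
  thus "r = Fract (d p * q - p * d q) (q * q)" using * assms by (simp add: eq_fract)
qed (use assms in blast)

lemma derivation_fract_deriv:
  assumes "derivation d"
  shows "derivation (fract_deriv d)"
proof
  interpret derivation d by fact
  fix x y :: "'a fract"
  obtain a b where x: "x = Fract a b" "b \<noteq> 0" by (cases x)
  obtain c e where y: "y = Fract c e" "e \<noteq> 0" by (cases y)
  show "fract_deriv d (x + y) = fract_deriv d x + fract_deriv d y"
    using x y assms by (simp add: fract_deriv_Fract eq_fract add mult) (simp add: algebra_simps)
  show "fract_deriv d (x * y) = fract_deriv d x * y + x * fract_deriv d y"
    using x y assms by (simp add: fract_deriv_Fract eq_fract add mult) (simp add: algebra_simps)
qed

text \<open>Comparing leading coefficients, \<open>p' q = p q'\<close> forces \<open>deg p = deg q\<close>; then a combination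
  of \<open>p\<close> and \<open>q\<close> of smaller degree satisfies the same equation, hence vanishes.\<close>

lemma pderiv_proportional_degree:
  fixes p q :: "'a::{idom,ring_char_0} poly"
  assumes "pderiv p * q = p * pderiv q" "p \<noteq> 0" "q \<noteq> 0"
  shows "degree p = degree q"
proof (cases "degree p = 0 \<or> degree q = 0")
  case True
  hence "pderiv p = 0 \<or> pderiv q = 0" by (auto simp: pderiv_eq_0_iff)
  hence "pderiv p = 0 \<and> pderiv q = 0" using assms by auto
  thus ?thesis by (simp add: pderiv_eq_0_iff)
next
  case False
  then obtain m n where mn: "degree p = Suc m" "degree q = Suc n"
    by (metis not0_implies_Suc)
  have lc: "lead_coeff (pderiv r) = of_nat (degree r) * lead_coeff r" for r :: "'a poly"
  proof (cases "degree r")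
    case 0
    thus ?thesis by (simp add: pderiv_eq_0_iff[THEN iffD2])
  qed (simp add: degree_pderiv coeff_pderiv)
  have "lead_coeff (pderiv p * q) = lead_coeff (p * pderiv q)" using assms by simp
  hence "of_nat (degree p) * lead_coeff p * lead_coeff q = lead_coeff p * (of_nat (degree q) * lead_coeff q)"
    unfolding lead_coeff_mult lc .
  hence "of_nat (degree p) = (of_nat (degree q) :: 'a)" using assms by (simp add: algebra_simps)
  thus ?thesis by simp
qed

lemma pderiv_proportional:
  fixes p q :: "'a::{idom,ring_char_0} poly"
  assumes "pderiv p * q = p * pderiv q" "q \<noteq> 0"
  shows "smult (lead_coeff q) p = smult (coeff p (degree q)) q"
proof -
  define r where "r = smult (lead_coeff q) p - smult (coeff p (degree q)) q"
  have "pderiv r * q = r * pderiv q"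
    using assms(1) by (simp add: r_def pderiv_diff pderiv_smult algebra_simps)
  moreover have "coeff r (degree q) = 0" by (simp add: r_def)
  \<comment> \<open>Were \<open>r\<close> nonzero, it would have the degree of \<open>q\<close>, but
    its coefficient there was just cancelled.\<close>
  ultimately have "r = 0"
    using pderiv_proportional_degree[of r q] assms(2) by (metis leading_coeff_0_iff)
  thus ?thesis by (simp add: r_def)
qed

section \<open>Regular functions and their values\<close>

lemma eval_poly2_simps [simp]:
  "eval_poly2 0 P = 0" "eval_poly2 1 P = 1"
  "eval_poly2 (p + q) P = eval_poly2 p P + eval_poly2 q P"
  "eval_poly2 (p * q) P = eval_poly2 p P * eval_poly2 q P"
  "eval_poly2 (pCons a p) P = poly a (P $ 1) + P $ 2 * eval_poly2 p P"
  by (simp_all add: eval_poly2_def)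

text \<open>The field is infinite: fixing the second coordinate leaves a polynomial in the first
  with infinitely many roots, so \<open>p\<close> has infinitely many constant roots in its outer
  variable.\<close>

lemma eval_poly2_eq_0:
  fixes p :: "'k::field_char_0 poly poly"
  assumes "\<And>P. eval_poly2 p P = 0"
  shows "p = 0"
proof -
  have "poly (poly p [:b:]) a = 0" for a b
    using assms[of "vector [a, b]"] by (simp add: eval_poly2_def)
  hence "poly p [:b:] = 0" for b
    using poly_all_0_iff_0 by blast
  hence "range (\<lambda>b. [:b:]) \<subseteq> {x. poly p x = 0}" by auto
  moreover have "infinite (range (\<lambda>b::'k. [:b:]))"
    by (subst finite_image_iff) (auto intro: injI simp: infinite_UNIV_char_0)
  ultimately show ?thesis using poly_roots_finite finite_subset by blast
qed

text \<open>One relation carries both regularity and value, so arithmetic on values needs no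
  separate regularity proofs.\<close>

definition has_value :: "'k::field ratfun \<Rightarrow> 'k ^ 2 \<Rightarrow> 'k \<Rightarrow> bool" where
  "has_value f P v \<longleftrightarrow> (\<exists>p q. f = Fraction_Field.Fract p q \<and> eval_poly2 q P \<noteq> 0
     \<and> v = eval_poly2 p P / eval_poly2 q P)"

lemma has_value_Fract:
  "eval_poly2 q P \<noteq> 0 \<Longrightarrow> has_value (Fract p q) P (eval_poly2 p P / eval_poly2 q P)"
  unfolding has_value_def by blast

lemma has_value_unique:
  assumes "has_value f P v" "has_value f P w"
  shows "v = w"
proof -
  obtain p q where 1: "f = Fract p q" "eval_poly2 q P \<noteq> 0" "v = eval_poly2 p P / eval_poly2 q P"
    using assms(1) unfolding has_value_def by blast
  obtain r s where 2: "f = Fract r s" "eval_poly2 s P \<noteq> 0" "w = eval_poly2 r P / eval_poly2 s P"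
    using assms(2) unfolding has_value_def by blast
  have "q \<noteq> 0" "s \<noteq> 0" using 1 2 by auto
  hence "p * s = r * q" using 1 2 by (simp add: eq_fract)
  hence "eval_poly2 p P * eval_poly2 s P = eval_poly2 r P * eval_poly2 q P"
    by (metis eval_poly2_simps(4))
  thus ?thesis using 1 2 by (simp add: frac_eq_eq)
qed

lemma regular_at_iff: "regular_at f P \<longleftrightarrow> (\<exists>v. has_value f P v)"
  unfolding regular_at_def has_value_def by blast

lemma ratfun_value_eq: "has_value f P v \<Longrightarrow> ratfun_value f P = v"
  unfolding ratfun_value_def has_value_def[symmetric]
  by (rule the_equality) (auto dest: has_value_unique)

lemma has_value_ratfun_value: "regular_at f P \<Longrightarrow> has_value f P (ratfun_value f P)"
  using ratfun_value_eq regular_at_iff by metis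

lemma has_value_add:
  assumes "has_value f P v" "has_value g P w"
  shows "has_value (f + g) P (v + w)"
proof -
  obtain p q where 1: "f = Fract p q" "eval_poly2 q P \<noteq> 0" "v = eval_poly2 p P / eval_poly2 q P"
    using assms(1) unfolding has_value_def by blast
  obtain r s where 2: "g = Fract r s" "eval_poly2 s P \<noteq> 0" "w = eval_poly2 r P / eval_poly2 s P"
    using assms(2) unfolding has_value_def by blast
  have "q \<noteq> 0" "s \<noteq> 0" using 1 2 by auto
  thus ?thesis using 1 2 has_value_Fract[of "q * s" P "p * s + r * q"]
    by (simp add: add_frac_eq)
qed

lemma has_value_mult:
  assumes "has_value f P v" "has_value g P w"
  shows "has_value (f * g) P (v * w)"
proof -
  obtain p q where 1: "f = Fract p q" "eval_poly2 q P \<noteq> 0" "v = eval_poly2 p P / eval_poly2 q P"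
    using assms(1) unfolding has_value_def by blast
  obtain r s where 2: "g = Fract r s" "eval_poly2 s P \<noteq> 0" "w = eval_poly2 r P / eval_poly2 s P"
    using assms(2) unfolding has_value_def by blast
  show ?thesis using 1 2 has_value_Fract[of "q * s" P "p * r"] by simp
qed

lemma has_value_inverse:
  assumes "has_value f P v" "v \<noteq> 0"
  shows "has_value (inverse f) P (inverse v)"
proof -
  obtain p q where 1: "f = Fract p q" "eval_poly2 q P \<noteq> 0" "v = eval_poly2 p P / eval_poly2 q P"
    using assms(1) unfolding has_value_def by blast
  show ?thesis using 1 assms has_value_Fract[of p P q] by simp
qed

lemma has_value_divide:
  assumes "has_value f P v" "has_value g P w" "w \<noteq> 0"
  shows "has_value (f / g) P (v / w)"
  using has_value_mult[OF assms(1) has_value_inverse[OF assms(2,3)]] by (simp add: divide_inverse)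

lemma has_value_const: "has_value (const_ratfun c) P c"
  using has_value_Fract[of 1 P "[:[:c:]:]"] by (simp add: const_ratfun_def)

lemma has_value_0: "has_value 0 P 0"
  using has_value_Fract[of 1 P 0] by (simp add: Zero_fract_def)

lemma ratfun_eqI:
  fixes f g :: "'k::field_char_0 ratfun"
  assumes "s \<noteq> 0"
    and "\<And>P. eval_poly2 s P \<noteq> 0 \<Longrightarrow> \<exists>v. has_value f P v \<and> has_value g P v"
  shows "f = g"
proof -
  obtain a b where f: "f = Fract a b" "b \<noteq> 0" by (cases f)
  obtain c d where g: "g = Fract c d" "d \<noteq> 0" by (cases g)
  \<comment> \<open>The factors \<open>s\<close>, \<open>b\<close> and \<open>d\<close> make the
    product vanish also at points where the hypothesis or the chosen fractions say nothing.\<close>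
  have "eval_poly2 ((a * d - c * b) * s * b * d) P = 0" for P
  proof (cases "eval_poly2 s P = 0 \<or> eval_poly2 b P = 0 \<or> eval_poly2 d P = 0")
    case False
    then obtain v where "has_value f P v" "has_value g P v" using assms(2) by blast
    hence "v = eval_poly2 a P / eval_poly2 b P" "v = eval_poly2 c P / eval_poly2 d P"
      using f g False has_value_Fract has_value_unique by blast+
    hence "eval_poly2 a P * eval_poly2 d P = eval_poly2 c P * eval_poly2 b P"
      using False by (simp add: frac_eq_eq)
    moreover have "eval_poly2 (a * d) P = eval_poly2 ((a * d - c * b) + c * b) P" by simp
    hence "eval_poly2 (a * d) P = eval_poly2 (a * d - c * b) P + eval_poly2 (c * b) P"
      unfolding eval_poly2_simps(3) .
    ultimately show ?thesis by simp
  qed auto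
  hence "(a * d - c * b) * s * b * d = 0" by (rule eval_poly2_eq_0)
  thus ?thesis using f g assms(1) by (simp add: eq_fract)
qed


section \<open>Substitution\<close>

interpretation const: field_hom "const_ratfun :: 'k::field \<Rightarrow> 'k ratfun"
  by unfold_locales (simp_all add: const_ratfun_def One_fract_def one_pCons)

definition poly_subst :: "'k::field ratmap \<Rightarrow> 'k poly poly \<Rightarrow> 'k ratfun" where
  "poly_subst \<phi> p = poly (map_poly (\<lambda>a. poly (map_poly const_ratfun a) (\<phi> $ 1)) p) (\<phi> $ 2)"

text \<open>The algebraic form of dominance, and what lets substitution extend to fractions.\<close>

definition alg_indep :: "'k::field ratmap \<Rightarrow> bool" where
  "alg_indep \<phi> \<longleftrightarrow> (\<forall>p. poly_subst \<phi> p = 0 \<longrightarrow> p = 0)"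

text \<open>The pullback of rational functions along \<phi>; meaningful when
  \<open>alg_indep \<phi>\<close> holds.\<close>

definition subst_ratfun :: "'k::field ratmap \<Rightarrow> 'k ratfun \<Rightarrow> 'k ratfun" where
  "subst_ratfun \<phi> = fract_ext (poly_subst \<phi>)"

lemma unital_hom_inner: "unital_hom (\<lambda>a. poly (map_poly const_ratfun a) (s :: 'k::field ratfun))"
  by (rule const.unital_hom_poly)

lemma unital_hom_poly_subst: "unital_hom (poly_subst \<phi>)"
  unfolding poly_subst_def by (rule unital_hom.unital_hom_poly[OF unital_hom_inner])

lemma poly_subst_0 [simp]: "poly_subst \<phi> 0 = 0"
  by (rule unital_hom.zero[OF unital_hom_poly_subst])

lemma poly_subst_pCons [simp]:
  "poly_subst \<phi> (pCons a p) = poly (map_poly const_ratfun a) (\<phi> $ 1) + \<phi> $ 2 * poly_subst \<phi> p"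
  unfolding poly_subst_def by (rule unital_hom.poly_map_poly_pCons[OF unital_hom_inner])

lemma coord_nth: "coord $ 1 = Fract [:[:0, 1:]:] 1" "coord $ 2 = Fract [:0, 1:] 1"
  by (simp_all add: coord_def)

lemma poly_const_ratfun_coord:
  "poly (map_poly const_ratfun a) (coord $ 1) = Fract [:a:] 1"
proof (induction a)
  case (pCons c a)
  thus ?case unfolding const.poly_map_poly_pCons pCons.IH by (simp add: coord_nth const_ratfun_def)
qed (simp add: Zero_fract_def)

lemma poly_subst_coord: "poly_subst coord p = Fract p 1"
  by (induction p) (simp_all add: poly_const_ratfun_coord coord_nth(2) Zero_fract_def)

lemma hom_poly_subst:
  assumes "unital_hom H" "\<And>c. H (const_ratfun c) = const_ratfun c"
  shows "H (poly_subst \<phi> p) = poly_subst (\<chi> i. H (\<phi> $ i)) p"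
proof -
  interpret unital_hom H by fact
  have "H (poly (map_poly const_ratfun a) s) = poly (map_poly const_ratfun a) (H s)" for a s
    by (induction a)
       (simp_all add: const.poly_map_poly_pCons zero add mult assms(2) del: map_poly_pCons)
  thus ?thesis by (induction p) (simp_all add: zero add mult)
qed

lemma field_hom_subst: "alg_indep \<phi> \<Longrightarrow> field_hom (subst_ratfun \<phi>)"
  unfolding subst_ratfun_def alg_indep_def
  by (intro field_hom_fract_ext unital_hom_poly_subst) blast

lemma subst_Fract:
  "alg_indep \<phi> \<Longrightarrow> q \<noteq> 0 \<Longrightarrow> subst_ratfun \<phi> (Fract p q) = poly_subst \<phi> p / poly_subst \<phi> q"
  unfolding subst_ratfun_def alg_indep_def
  by (intro fract_ext_Fract unital_hom_poly_subst) blast+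

lemma subst_const: "alg_indep \<phi> \<Longrightarrow> subst_ratfun \<phi> (const_ratfun c) = const_ratfun c"
  using subst_Fract[of \<phi> 1 "[:[:c:]:]"]
  by (simp add: const.poly_map_poly_pCons unital_hom.one[OF unital_hom_poly_subst]
      flip: const_ratfun_def del: map_poly_pCons)

lemma subst_coord: "alg_indep \<phi> \<Longrightarrow> subst_ratfun \<phi> (coord $ i) = \<phi> $ i"
  using exhaust_2[of i]
  by (auto simp: coord_nth subst_Fract unital_hom.one[OF unital_hom_poly_subst] map_poly_pCons
      const.one const.zero)

lemma alg_indep_coord: "alg_indep coord"
  by (simp add: alg_indep_def poly_subst_coord Zero_fract_def eq_fract)

lemma subst_by_coord: "subst_ratfun coord f = f"
  by (cases f) (simp add: subst_Fract alg_indep_coord poly_subst_coord)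

text \<open>\<open>H\<close> carries a relation among the components of \<phi> to one among their
  images.\<close>

lemma alg_indep_if_hom:
  assumes "unital_hom H" "\<And>c. H (const_ratfun c) = const_ratfun c" "alg_indep (\<chi> i. H (\<phi> $ i))"
  shows "alg_indep \<phi>"
  using assms(3) hom_poly_subst[OF assms(1,2)] unital_hom.zero[OF assms(1)]
  unfolding alg_indep_def by metis

text \<open>\<open>H\<close> is injective, so it creates no new relations, and as a homomorphism
  over \<open>k\<close> it commutes with forming rational expressions.\<close>

lemma hom_subst:
  assumes "field_hom H" "\<And>c. H (const_ratfun c) = const_ratfun c" "alg_indep \<phi>"
  shows "alg_indep (\<chi> i. H (\<phi> $ i))"
    and "H (subst_ratfun \<phi> f) = subst_ratfun (\<chi> i. H (\<phi> $ i)) f"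
proof -
  interpret field_hom H by fact
  note * = hom_poly_subst[OF unital_hom_axioms assms(2)]
  show indep: "alg_indep (\<chi> i. H (\<phi> $ i))"
    using assms(3) by (simp add: alg_indep_def flip: * add: eq_0_iff)
  show "H (subst_ratfun \<phi> f) = subst_ratfun (\<chi> i. H (\<phi> $ i)) f"
    by (cases f) (simp add: subst_Fract assms(3) indep divide *)
qed

text \<open>The case of \<open>hom_subst\<close> where \<open>H\<close> is itself a pullback:
  pullbacks compose contravariantly.\<close>

lemma subst_subst:
  assumes "alg_indep \<phi>" "alg_indep \<psi>"
  shows "alg_indep (\<chi> i. subst_ratfun \<phi> (\<psi> $ i))"
    and "subst_ratfun \<phi> (subst_ratfun \<psi> f) = subst_ratfun (\<chi> i. subst_ratfun \<phi> (\<psi> $ i)) f"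
  using hom_subst[OF field_hom_subst[OF assms(1)] subst_const[OF assms(1)] assms(2)] by blast+

section \<open>Dominant maps\<close>

lemma has_value_poly_subst:
  assumes "\<And>i. has_value (\<phi> $ i) P (Q $ i)"
  shows "has_value (poly_subst \<phi> p) P (eval_poly2 p Q)"
proof -
  have "has_value (poly (map_poly const_ratfun a) (\<phi> $ 1)) P (poly a (Q $ 1))" for a
    by (induction a) (simp_all add: has_value_0 const.poly_map_poly_pCons del: map_poly_pCons,
        intro has_value_add has_value_mult has_value_const assms)
  thus ?thesis
    by (induction p) (simp_all add: has_value_0, intro has_value_add has_value_mult assms)
qed

lemma ratmap_domD:
  "P \<in> ratmap_dom \<phi> \<Longrightarrow> has_value (\<phi> $ i) P (ratmap_value \<phi> P $ i)"
  by (simp add: ratmap_dom_def ratmap_value_def has_value_ratfun_value)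

lemma ratmap_domI:
  assumes "\<And>i. has_value (\<phi> $ i) P (Q $ i)"
  shows "P \<in> ratmap_dom \<phi>" "ratmap_value \<phi> P = Q"
  using assms ratfun_value_eq
  by (fastforce simp: ratmap_dom_def regular_at_iff ratmap_value_def vec_eq_iff)+

lemma ratmap_dom_principal_open:
  obtains s where "s \<noteq> 0" "\<And>P. eval_poly2 s P \<noteq> 0 \<Longrightarrow> P \<in> ratmap_dom \<phi>"
proof -
  obtain a b where 1: "\<phi> $ 1 = Fract a b" "b \<noteq> 0" by (cases "\<phi> $ 1")
  obtain c d where 2: "\<phi> $ 2 = Fract c d" "d \<noteq> 0" by (cases "\<phi> $ 2")
  have "P \<in> ratmap_dom \<phi>" if "eval_poly2 (b * d) P \<noteq> 0" for P
    using that has_value_Fract[of b P a] has_value_Fract[of d P c]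
    by (auto simp: ratmap_dom_def forall_2 regular_at_iff 1 2)
  thus ?thesis using that[of "b * d"] 1 2 by simp
qed

text \<open>A polynomial vanishes on the image exactly when substituting \<phi> into it gives zero,
  since a rational function that vanishes on a nonempty principal open set is zero.\<close>

lemma dominant_iff_alg_indep:
  fixes \<phi> :: "'k::field_char_0 ratmap"
  shows "dominant \<phi> \<longleftrightarrow> alg_indep \<phi>"
proof
  assume dom: "dominant \<phi>"
  show "alg_indep \<phi>"
    unfolding alg_indep_def
  proof (intro allI impI)
    fix p assume p: "poly_subst \<phi> p = 0"
    let ?Z = "{P. eval_poly2 p P = 0}"
    have "eval_poly2 p (ratmap_value \<phi> P) = 0" if "P \<in> ratmap_dom \<phi>" for P
      using has_value_poly_subst[OF ratmap_domD[OF that], of p] p has_value_0 has_value_unique by metis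
    moreover have "zariski_closed ?Z" unfolding zariski_closed_def by (rule exI[of _ "{p}"]) auto
    ultimately have "?Z = UNIV" using dom unfolding dominant_def zariski_dense_def by blast
    thus "p = 0" by (intro eval_poly2_eq_0) blast
  qed
next
  assume indep: "alg_indep \<phi>"
  show "dominant \<phi>"
    unfolding dominant_def zariski_dense_def
  proof (intro allI impI, elim conjE)
    fix Z :: "('k ^ 2) set"
    assume "zariski_closed Z" and sub: "ratmap_value \<phi> ` ratmap_dom \<phi> \<subseteq> Z"
    then obtain S where S: "Z = {P. \<forall>p\<in>S. eval_poly2 p P = 0}" unfolding zariski_closed_def by blast
    have "p = 0" if "p \<in> S" for p
    proof -
      obtain s where s: "s \<noteq> 0" "\<And>P. eval_poly2 s P \<noteq> 0 \<Longrightarrow> P \<in> ratmap_dom \<phi>"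
        by (rule ratmap_dom_principal_open[of \<phi>]) blast
      have "poly_subst \<phi> p = 0"
      proof (rule ratfun_eqI[OF s(1)])
        fix P assume "eval_poly2 s P \<noteq> 0"
        hence P: "P \<in> ratmap_dom \<phi>" by (rule s)
        hence "eval_poly2 p (ratmap_value \<phi> P) = 0" using sub S that by blast
        thus "\<exists>v. has_value (poly_subst \<phi> p) P v \<and> has_value 0 P v"
          using has_value_poly_subst[OF ratmap_domD[OF P], of p] has_value_0 by metis
      qed
      thus ?thesis using indep unfolding alg_indep_def by blast
    qed
    hence "\<forall>p\<in>S. eval_poly2 p P = 0" for P by (metis eval_poly2_simps(1))
    thus "Z = UNIV" using S by simp
  qed
qed

lemma has_value_subst:
  assumes "alg_indep \<phi>" "\<And>i. has_value (\<phi> $ i) P (Q $ i)" "has_value f Q v"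
  shows "has_value (subst_ratfun \<phi> f) P v"
proof -
  obtain p q where *: "f = Fract p q" "eval_poly2 q Q \<noteq> 0" "v = eval_poly2 p Q / eval_poly2 q Q"
    using assms(3) unfolding has_value_def by blast
  have "q \<noteq> 0" using * by auto
  thus ?thesis using * assms
    by (auto simp: subst_Fract intro!: has_value_divide has_value_poly_subst)
qed

text \<open>The pulled-back components satisfy the description of the composite, and any two maps
  satisfying it agree on a nonempty principal open set.\<close>

lemma ratmap_comp_eq_subst:
  fixes \<phi> :: "'k::field_char_0 ratmap"
  assumes indep: "alg_indep \<phi>"
  shows "ratmap_comp \<psi> \<phi> = (\<chi> i. subst_ratfun \<phi> (\<psi> $ i))"
  unfolding ratmap_comp_def
proof (rule the_equality)
  let ?\<theta> = "\<chi> i. subst_ratfun \<phi> (\<psi> $ i)"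
  have "has_value (?\<theta> $ i) P (ratmap_value \<psi> (ratmap_value \<phi> P) $ i)"
    if "P \<in> ratmap_dom \<phi>" "ratmap_value \<phi> P \<in> ratmap_dom \<psi>" for P i
    using has_value_subst[OF indep ratmap_domD[OF that(1)] ratmap_domD[OF that(2)]] by simp
  thus comp: "\<forall>P\<in>ratmap_dom \<phi>. ratmap_value \<phi> P \<in> ratmap_dom \<psi> \<longrightarrow>
      P \<in> ratmap_dom ?\<theta> \<and> ratmap_value ?\<theta> P = ratmap_value \<psi> (ratmap_value \<phi> P)"
    using ratmap_domI by blast
  fix \<theta> assume \<theta>: "\<forall>P\<in>ratmap_dom \<phi>. ratmap_value \<phi> P \<in> ratmap_dom \<psi> \<longrightarrow>
      P \<in> ratmap_dom \<theta> \<and> ratmap_value \<theta> P = ratmap_value \<psi> (ratmap_value \<phi> P)"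
  obtain s where s: "s \<noteq> 0" "\<And>P. eval_poly2 s P \<noteq> 0 \<Longrightarrow> P \<in> ratmap_dom \<phi>"
    by (rule ratmap_dom_principal_open[of \<phi>]) blast
  obtain t where t: "t \<noteq> 0" "\<And>P. eval_poly2 t P \<noteq> 0 \<Longrightarrow> P \<in> ratmap_dom \<psi>"
    by (rule ratmap_dom_principal_open[of \<psi>]) blast
  \<comment> \<open>Where \<open>s\<close>, \<open>a\<close> and \<open>b\<close> do not vanish,
    \<phi> maps into the locus \<open>t \<noteq> 0\<close>, inside the domain of \<psi>.
    Independence of \<phi> makes \<open>a\<close> nonzero.\<close>
  obtain a b where ab: "poly_subst \<phi> t = Fract a b" "b \<noteq> 0" by (cases "poly_subst \<phi> t")
  have "a \<noteq> 0" using ab t indep unfolding alg_indep_def by (metis Zero_fract_def eq_fract(3))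
  have good: "P \<in> ratmap_dom \<phi>" "ratmap_value \<phi> P \<in> ratmap_dom \<psi>"
    if "eval_poly2 (s * a * b) P \<noteq> 0" for P
  proof -
    show P: "P \<in> ratmap_dom \<phi>" using that s by simp
    have "eval_poly2 t (ratmap_value \<phi> P) = eval_poly2 a P / eval_poly2 b P"
      using has_value_poly_subst[OF ratmap_domD[OF P], of t] has_value_Fract[of b P a] ab that
        has_value_unique by fastforce
    thus "ratmap_value \<phi> P \<in> ratmap_dom \<psi>" using that t by simp
  qed
  show "\<theta> = ?\<theta>"
    unfolding vec_eq_iff
  proof
    fix i
    show "\<theta> $ i = ?\<theta> $ i"
    proof (rule ratfun_eqI)
      show "s * a * b \<noteq> 0" using s \<open>a \<noteq> 0\<close> ab by simp
      fix P assume "eval_poly2 (s * a * b) P \<noteq> 0"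
      note good[OF this]
      thus "\<exists>v. has_value (\<theta> $ i) P v \<and> has_value (?\<theta> $ i) P v"
        using \<theta> comp ratmap_domD by metis
    qed
  qed
qed

section \<open>The Jacobian criterion\<close>

definition dx :: "'k::field ratfun \<Rightarrow> 'k ratfun" where
  "dx = fract_deriv (map_poly pderiv)"

definition dy :: "'k::field ratfun \<Rightarrow> 'k ratfun" where
  "dy = fract_deriv pderiv"

lemmas derivation_map_poly_pderiv = derivation.derivation_map_poly[OF derivation_pderiv]

interpretation dx: derivation "dx :: 'k::field ratfun \<Rightarrow> 'k ratfun"
  unfolding dx_def by (rule derivation_fract_deriv[OF derivation_map_poly_pderiv])

interpretation dy: derivation "dy :: 'k::field ratfun \<Rightarrow> 'k ratfun"
  unfolding dy_def by (rule derivation_fract_deriv[OF derivation_pderiv])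

lemma dx_Fract:
  "q \<noteq> 0 \<Longrightarrow> dx (Fract p q) = Fract (map_poly pderiv p * q - p * map_poly pderiv q) (q * q)"
  unfolding dx_def by (rule fract_deriv_Fract[OF derivation_map_poly_pderiv])

lemma dy_Fract: "q \<noteq> 0 \<Longrightarrow> dy (Fract p q) = Fract (pderiv p * q - p * pderiv q) (q * q)"
  unfolding dy_def by (rule fract_deriv_Fract[OF derivation_pderiv])

lemma dx_const [simp]: "dx (const_ratfun c) = 0"
  by (simp add: const_ratfun_def dx_Fract map_poly_pCons Zero_fract_def
      derivation.one[OF derivation_map_poly_pderiv])

lemma dy_const [simp]: "dy (const_ratfun c) = 0"
  by (simp add: const_ratfun_def dy_Fract Zero_fract_def)

lemma dx_coord [simp]: "dx (coord $ 1) = 1" "dx (coord $ 2) = 0"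
  by (simp_all add: coord_nth dx_Fract map_poly_pCons pderiv_pCons Zero_fract_def One_fract_def one_pCons)

lemma dy_coord [simp]: "dy (coord $ 1) = 0" "dy (coord $ 2) = 1"
  by (simp_all add: coord_nth dy_Fract pderiv_pCons Zero_fract_def One_fract_def one_pCons)

lemma Fract_eq_0_iff: "q \<noteq> 0 \<Longrightarrow> Fract p q = 0 \<longleftrightarrow> p = 0"
  by (simp add: Zero_fract_def eq_fract)

text \<open>The condition on \<open>dy\<close> makes numerator and denominator proportional over
  \<open>k[x]\<close>, so \<open>f\<close> is a quotient of polynomials in \<open>x\<close>; the
  condition on \<open>dx\<close> then makes those proportional over \<open>k\<close>.\<close>

lemma const_if_derivs_eq_0:
  fixes f :: "'k::field_char_0 ratfun"
  assumes "dx f = 0" "dy f = 0"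
  obtains c where "f = const_ratfun c"
proof -
  obtain p q where f: "f = Fract p q" "q \<noteq> 0" by (cases f)
  have "pderiv p * q = p * pderiv q"
    using assms(2) f by (simp add: dy_Fract Fract_eq_0_iff)
  hence "smult (lead_coeff q) p = smult (coeff p (degree q)) q"
    using f(2) by (rule pderiv_proportional)
  then obtain a b where "smult b p = smult a q" "b \<noteq> 0"
    using f(2) by (metis leading_coeff_0_iff)
  hence f': "f = Fract [:a:] [:b:]" "b \<noteq> 0"
    using f by (simp_all add: eq_fract mult.commute)
  have "pderiv a * b = a * pderiv b"
    using assms(1) f' by (simp add: dx_Fract map_poly_pCons Fract_eq_0_iff mult.commute)
  hence "smult (lead_coeff b) a = smult (coeff a (degree b)) b"
    using f'(2) by (rule pderiv_proportional)
  then obtain c d where cd: "smult d a = smult c b" "d \<noteq> 0"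
    using f'(2) by (metis leading_coeff_0_iff)
  have "a = smult (inverse d) (smult d a)" using cd(2) by simp
  also have "\<dots> = smult (c / d) b" unfolding cd(1) by (simp add: divide_inverse mult.commute)
  finally have "f = const_ratfun (c / d)"
    using f' by (simp add: const_ratfun_def eq_fract)
  thus ?thesis by (rule that)
qed

text \<open>The Jacobian determinant, used as a derivation in its second argument that kills the
  first.\<close>

definition jac :: "'k::field ratfun \<Rightarrow> 'k ratfun \<Rightarrow> 'k ratfun" where
  "jac f g = dx f * dy g - dy f * dx g"

interpretation jac: derivation "jac f" for f :: "'k::field ratfun"
  by unfold_locales (simp_all add: jac_def dx.add dx.mult dy.add dy.mult algebra_simps)

lemma jac_const [simp]: "jac f (const_ratfun c) = 0"
  by (simp add: jac_def)

lemma jac_self [simp]: "jac f f = 0"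
  by (simp add: jac_def)

lemma jac_swap: "jac f g = - jac g f"
  by (simp add: jac_def)

text \<open>A nontrivial relation would make the second component algebraic over functions killed by
  \<open>jac (\<phi> $ 1)\<close>, hence killed as well.\<close>

lemma jacobian_criterion:
  fixes \<phi> :: "'k::field_char_0 ratmap"
  assumes "jac (\<phi> $ 1) (\<phi> $ 2) \<noteq> 0"
  shows "alg_indep \<phi>"
  unfolding alg_indep_def
proof (intro allI impI, rule ccontr)
  fix p assume p: "poly_subst \<phi> p = 0" "p \<noteq> 0"
  let ?inner = "\<lambda>a. poly (map_poly const_ratfun a) (\<phi> $ 1)"
  \<comment> \<open>The first component is transcendental over \<open>k\<close>, by the same
    argument with \<open>jac (\<phi> $ 2)\<close>; thus the relation stays nontrivial in the outer
    variable.\<close>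
  have inner: "a = 0" if "?inner a = 0" for a
  proof (rule ccontr)
    assume "a \<noteq> 0"
    hence "map_poly const_ratfun a \<noteq> 0"
      by (subst map_poly_eq_0_iff) (auto simp: const.zero const.eq_0_iff)
    moreover have "jac (\<phi> $ 2) (coeff (map_poly const_ratfun a) i) = 0" for i
      by (simp add: coeff_map_poly const.zero)
    ultimately have "jac (\<phi> $ 2) (\<phi> $ 1) = 0"
      using that by (rule derivation_algebraic[OF jac.derivation_axioms])
    with assms show False by (simp add: jac_swap[of "\<phi> $ 1"])
  qed
  have "map_poly ?inner p \<noteq> 0"
    using p inner by (subst map_poly_eq_0_iff) auto
  moreover have "jac (\<phi> $ 1) (coeff (map_poly ?inner p) i) = 0" for i
    by (simp add: coeff_map_poly const.zero jac.poly)
  ultimately have "jac (\<phi> $ 1) (\<phi> $ 2) = 0"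
    using p(1)[unfolded poly_subst_def] by (rule derivation_algebraic[OF jac.derivation_axioms])
  with assms show False ..
qed


section \<open>Linear maps\<close>

definition const_mat :: "'k::field ^ 2 ^ 2 \<Rightarrow> 'k ratfun ^ 2 ^ 2" where
  "const_mat A = (\<chi> i j. const_ratfun (A $ i $ j))"

lemma linear_ratmap_eq: "linear_ratmap A = const_mat A *v coord"
  by (simp add: linear_ratmap_def const_mat_def)

lemma const_mat_vec_nth:
  "(const_mat A *v v) $ i = const_ratfun (A $ i $ 1) * v $ 1 + const_ratfun (A $ i $ 2) * v $ 2"
  by (simp add: const_mat_def matrix_vector_mult_def sum_2)

lemma const_mat_mult: "const_mat (A ** B) = const_mat A ** const_mat B"
  by (simp add: const_mat_def matrix_matrix_mult_def vec_eq_iff const.sum const.mult)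

lemma const_mat_1: "const_mat (mat 1) = mat 1"
  by (simp add: const_mat_def mat_def vec_eq_iff const.zero const.one)

lemma hom_const_mat_vec:
  assumes "unital_hom H" "\<And>c. H (const_ratfun c) = const_ratfun c"
  shows "H ((const_mat A *v v) $ i) = (const_mat A *v (\<chi> j. H (v $ j))) $ i"
  using assms by (simp add: const_mat_vec_nth unital_hom.add unital_hom.mult)

lemma ratmap_comp_linear:
  fixes \<phi> :: "'k::field_char_0 ratmap"
  assumes "alg_indep \<phi>"
  shows "ratmap_comp (linear_ratmap A) \<phi> = const_mat A *v \<phi>"
proof -
  interpret field_hom "subst_ratfun \<phi>" by (rule field_hom_subst[OF assms])
  show ?thesis
    unfolding ratmap_comp_eq_subst[OF assms] linear_ratmap_eq vec_eq_iff
    using hom_const_mat_vec[OF unital_hom_axioms subst_const[OF assms]]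
    by (simp add: subst_coord assms)
qed

lemma alg_indep_linear:
  fixes A :: "'k::field_char_0 ^ 2 ^ 2"
  assumes "invertible A"
  shows "alg_indep (linear_ratmap A)"
proof (rule jacobian_criterion)
  have "jac (linear_ratmap A $ 1) (linear_ratmap A $ 2) = const_ratfun (det A)"
    by (simp add: linear_ratmap_eq const_mat_vec_nth jac_def dx.add dx.mult dy.add dy.mult
        det_2 const.diff const.mult)
  thus "jac (linear_ratmap A $ 1) (linear_ratmap A $ 2) \<noteq> 0"
    using assms by (simp add: const.eq_0_iff invertible_det_nz)
qed

lemma linear_ratmap_comp:
  fixes A B :: "'k::field_char_0 ^ 2 ^ 2"
  assumes "invertible B"
  shows "ratmap_comp (linear_ratmap A) (linear_ratmap B) = linear_ratmap (A ** B)"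
  using ratmap_comp_linear[OF alg_indep_linear[OF assms]]
  by (simp add: linear_ratmap_eq const_mat_mult matrix_vector_mul_assoc)

lemma linear_ratmap_1: "linear_ratmap (mat 1) = coord"
  by (simp add: linear_ratmap_eq const_mat_1)

lemma linear_ratmap_inj: "linear_ratmap A = linear_ratmap B \<Longrightarrow> A = B"
proof -
  have *: "dx (linear_ratmap A $ i) = const_ratfun (A $ i $ 1)"
      "dy (linear_ratmap A $ i) = const_ratfun (A $ i $ 2)" for A :: "'a ^ 2 ^ 2" and i
    by (simp_all add: linear_ratmap_eq const_mat_vec_nth dx.add dx.mult dy.add dy.mult)
  assume "linear_ratmap A = linear_ratmap B"
  hence "A $ i $ 1 = B $ i $ 1 \<and> A $ i $ 2 = B $ i $ 2" for i
    using *[of A i] *[of B i] by (simp add: const.eq_iff)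
  thus ?thesis by (simp add: vec_eq_iff forall_2)
qed

lemma linear_ratmap_in_Bir:
  fixes A :: "'k::field_char_0 ^ 2 ^ 2"
  assumes "invertible A"
  shows "linear_ratmap A \<in> carrier Bir"
proof -
  obtain B where B: "A ** B = mat 1" "B ** A = mat 1" using assms unfolding invertible_def by blast
  hence "invertible B" unfolding invertible_def by blast
  hence "dominant (linear_ratmap A)" "dominant (linear_ratmap B)"
      "ratmap_comp (linear_ratmap B) (linear_ratmap A) = coord"
      "ratmap_comp (linear_ratmap A) (linear_ratmap B) = coord"
    using assms B
    by (simp_all add: dominant_iff_alg_indep alg_indep_linear linear_ratmap_comp linear_ratmap_1)
  thus ?thesis unfolding Bir_def by auto
qed

lemma rational_action_linear:
  fixes lam :: "'g \<Rightarrow> 'k::field_char_0 ^ 2 ^ 2"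
  assumes "lam \<in> mon G GL2"
  shows "rational_action G (\<lambda>g. linear_ratmap (lam g))"
proof -
  have inv: "invertible (lam g)" if "g \<in> carrier G" for g
    using assms that by (auto simp: mon_def hom_def GL2_def)
  have "lam (g \<otimes>\<^bsub>G\<^esub> h) = lam g ** lam h" if "g \<in> carrier G" "h \<in> carrier G" for g h
    using assms that by (simp add: mon_def hom_def GL2_def)
  moreover have "inj_on lam (carrier G)" using assms by (simp add: mon_def)
  ultimately show ?thesis
    unfolding rational_action_def mon_def hom_def
    using inv
    by (auto simp: linear_ratmap_in_Bir inj_on_def dest: linear_ratmap_inj)
       (simp add: Bir_def linear_ratmap_comp)
qed

lemma Bir_alg_indep:
  fixes \<phi> :: "'k::field_char_0 ratmap"
  shows "\<phi> \<in> carrier Bir \<Longrightarrow> alg_indep \<phi>"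
  by (simp add: Bir_def dominant_iff_alg_indep)

text \<open>The preimage of \<open>f\<close> is its pullback along the inverse map.
  \<open>homothety_not_Bir\<close> refutes this surjectivity.\<close>

lemma Bir_subst_surj:
  fixes \<phi> :: "'k::field_char_0 ratmap"
  assumes "\<phi> \<in> carrier Bir"
  obtains w where "subst_ratfun \<phi> w = f"
proof -
  from assms obtain \<psi> where \<psi>: "alg_indep \<psi>" "ratmap_comp \<psi> \<phi> = coord"
    by (auto simp: Bir_def dominant_iff_alg_indep)
  note indep = Bir_alg_indep[OF assms]
  have "subst_ratfun \<phi> (subst_ratfun \<psi> f) = f"
    using subst_subst(2)[OF indep \<psi>(1)] \<psi>(2) by (simp add: ratmap_comp_eq_subst indep subst_by_coord)
  thus ?thesis by (rule that)
qed

section \<open>Independence of characters, unipotent matrices and roots of unity\<close>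

lemma dedekind_independence:
  fixes \<xi> :: "'s \<Rightarrow> 'a::comm_monoid_mult \<Rightarrow> 'b::field"
  assumes "finite S"
    and "\<And>s. s \<in> S \<Longrightarrow> \<xi> s 1 = 1"
    and "\<And>s x y. s \<in> S \<Longrightarrow> \<xi> s (x * y) = \<xi> s x * \<xi> s y"
    and "\<And>s t. s \<in> S \<Longrightarrow> t \<in> S \<Longrightarrow> s \<noteq> t \<Longrightarrow> \<exists>x. \<xi> s x \<noteq> \<xi> t x"
    and "\<And>x. (\<Sum>s\<in>S. c s * \<xi> s x) = 0"
    and "t \<in> S"
  shows "c t = 0"
  using assms
proof (induction S arbitrary: c t rule: finite_induct)
  case (insert s S)
  have S: "c t = 0" if "t \<in> S" for t
  proof -
    have "s \<noteq> t" using insert.hyps that by blast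
    then obtain y where y: "\<xi> s y \<noteq> \<xi> t y" using insert.prems(3) \<open>t \<in> S\<close> by blast
    \<comment> \<open>The relation at \<open>y * x\<close> minus \<open>\<xi> s y\<close> times the
      relation at \<open>x\<close>: the term of \<open>s\<close> cancels.\<close>
    have "(\<Sum>u\<in>S. c u * (\<xi> u y - \<xi> s y) * \<xi> u x) = 0" for x
    proof -
      have "(\<Sum>u\<in>S. c u * (\<xi> u y - \<xi> s y) * \<xi> u x) =
          (\<Sum>u\<in>insert s S. c u * (\<xi> u y - \<xi> s y) * \<xi> u x)"
        using insert.hyps by simp
      also have "\<dots> = (\<Sum>u\<in>insert s S. c u * \<xi> u (y * x) - \<xi> s y * (c u * \<xi> u x))"
        by (intro sum.cong refl) (simp add: insert.prems(2) algebra_simps)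
      also have "\<dots> = (\<Sum>u\<in>insert s S. c u * \<xi> u (y * x)) - \<xi> s y * (\<Sum>u\<in>insert s S. c u * \<xi> u x)"
        by (simp only: sum_subtractf sum_distrib_left)
      also have "\<dots> = 0" by (simp only: insert.prems(4)) simp
      finally show ?thesis .
    qed
    hence "c t * (\<xi> t y - \<xi> s y) = 0"
      using insert.IH[of "\<lambda>u. c u * (\<xi> u y - \<xi> s y)" t] insert.prems(1-3) \<open>t \<in> S\<close> by blast
    thus ?thesis using y by simp
  qed
  have "c s = (\<Sum>u\<in>insert s S. c u * \<xi> u 1)"
    using insert.hyps insert.prems(1) S by simp
  hence "c s = 0" by (simp only: insert.prems(4))
  thus ?case using S insert.prems(5) by blast
qed simp

text \<open>Fixing the row determines the second row of \<open>M\<close> from the first; the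
  determinant then leaves only \<open>M $ 1 $ 2\<close> free.\<close>

lemma det_one_fixing_row:
  fixes M :: "'k::field ^ 2 ^ 2"
  assumes "vector [e, 1] v* M = vector [e, 1]" "det M = 1"
  shows "M = vector [vector [1 + e * M $ 1 $ 2, M $ 1 $ 2], vector [- (e * e) * M $ 1 $ 2, 1 - e * M $ 1 $ 2]]"
proof -
  have 1: "e * M $ 1 $ 1 + M $ 2 $ 1 = e" and 2: "e * M $ 1 $ 2 + M $ 2 $ 2 = 1"
    using assms(1) by (simp_all add: vector_matrix_mult_def vec_eq_iff forall_2 sum_2 mult.commute)
  have 3: "M $ 1 $ 1 * M $ 2 $ 2 - M $ 1 $ 2 * M $ 2 $ 1 = 1" using assms(2) by (simp add: det_2)
  have s: "M $ 2 $ 2 = 1 - e * M $ 1 $ 2" and r: "M $ 2 $ 1 = e - e * M $ 1 $ 1"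
    using 1 2 by (simp_all add: algebra_simps)
  have p: "M $ 1 $ 1 = 1 + e * M $ 1 $ 2"
    using 3 unfolding s r by (simp add: algebra_simps)
  show ?thesis using s r p by (simp add: vec_eq_iff forall_2 algebra_simps)
qed

text \<open>The identity plus \<open>q\<close> times a fixed matrix of square zero, hence a
  homomorphism from the additive group in \<open>q\<close>.\<close>

definition unipotent :: "'k::field \<Rightarrow> 'k \<Rightarrow> 'k ^ 2 ^ 2" where
  "unipotent e q = vector [vector [1 + e * q, q], vector [- (e * e) * q, 1 - e * q]]"

lemma unipotent_mult: "unipotent e q ** unipotent e r = unipotent e (q + r)"
  by (simp add: unipotent_def matrix_matrix_mult_def vec_eq_iff forall_2 sum_2 algebra_simps)

lemma unipotent_0: "unipotent e 0 = mat 1"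
  by (simp add: unipotent_def mat_def vec_eq_iff forall_2)

lemma unipotent_eq_iff: "unipotent e q = unipotent e r \<longleftrightarrow> q = r"
  by (auto simp: unipotent_def vec_eq_iff forall_2)

text \<open>Take a root of \<open>1 + z + ... + z ^ n\<close>; at \<open>z = 1\<close> this sum is
  \<open>n + 1\<close>, which is nonzero.\<close>

lemma ex_nontrivial_root_of_unity:
  assumes "n > 0"
  shows "\<exists>z :: 'k::{alg_closed_field,field_char_0}. z ^ Suc n = 1 \<and> z \<noteq> 1"
proof -
  obtain z :: 'k where z: "(\<Sum>i\<le>n. 1 * z ^ i) = 0"
    using alg_closed[of n "\<lambda>_. 1"] assms by auto
  have "(1 - z) * (\<Sum>i\<le>n. z ^ i) = 1 - z ^ Suc n" by (rule sum_gp_basic)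
  hence "z ^ Suc n = 1" using z by simp
  moreover have "z \<noteq> 1"
  proof
    assume "z = 1"
    with z have "of_nat (Suc n) = (0 :: 'k)" by simp
    thus False by (simp only: of_nat_eq_0_iff)
  qed
  ultimately show ?thesis by blast
qed

text \<open>With \<open>t = w $ 1 / w $ 2\<close> and \<open>s = w $ 2\<close>, this reduces the
  Jacobian of \<open>w\<close> to \<open>jac t (w $ 2)\<close>.\<close>

lemma jac_times_self: "jac (t * s) s = jac t s * s"
  by (simp add: jac_def dx.mult dy.mult algebra_simps)

section \<open>Equivariant maps\<close>

locale action_setup = group G for G (structure) +
  fixes lam :: "'a \<Rightarrow> 'k::{alg_closed_field,field_char_0} ^ 2 ^ 2"
    and \<rho> :: "'a \<Rightarrow> 'k ratmap"
  assumes fin: "finite (carrier G)"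
    and nonabelian: "\<not> comm_group G"
    and lam: "lam \<in> mon G GL2"
    and \<rho>: "rational_action G \<rho>"
begin

lemma lam_mult: "g \<in> carrier G \<Longrightarrow> h \<in> carrier G \<Longrightarrow> lam (g \<otimes> h) = lam g ** lam h"
  using lam by (simp add: mon_def hom_def GL2_def)

lemma lam_invertible: "g \<in> carrier G \<Longrightarrow> invertible (lam g)"
  using lam by (auto simp: mon_def hom_def GL2_def)

lemma lam_inj: "inj_on lam (carrier G)"
  using lam by (simp add: mon_def)

lemma lam_one: "lam \<one> = mat 1"
proof -
  obtain B where B: "B ** lam \<one> = mat 1"
    using lam_invertible[OF one_closed] unfolding invertible_def by blast
  have "B ** lam \<one> = B ** (lam \<one> ** lam \<one>)" by (simp flip: lam_mult)
  thus ?thesis using B by (simp add: matrix_mul_assoc)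
qed

section \<open>The action on the function field and equivariant pairs\<close>

definition act :: "'a \<Rightarrow> 'k ratfun \<Rightarrow> 'k ratfun" where
  "act g = subst_ratfun (\<rho> g)"

lemma \<rho>_Bir: "g \<in> carrier G \<Longrightarrow> \<rho> g \<in> carrier Bir"
  using \<rho> by (auto simp: rational_action_def mon_def hom_def)

lemma \<rho>_alg_indep: "g \<in> carrier G \<Longrightarrow> alg_indep (\<rho> g)"
  by (rule Bir_alg_indep[OF \<rho>_Bir])

lemma field_hom_act: "g \<in> carrier G \<Longrightarrow> field_hom (act g)"
  unfolding act_def by (intro field_hom_subst \<rho>_alg_indep)

lemma unital_hom_act: "g \<in> carrier G \<Longrightarrow> unital_hom (act g)"
  using field_hom_act by (rule field_hom.axioms)

lemma act_const: "g \<in> carrier G \<Longrightarrow> act g (const_ratfun c) = const_ratfun c"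
  unfolding act_def by (intro subst_const \<rho>_alg_indep)

text \<open>Pullback reverses composition, so \<open>act\<close> is a right action; sums and
  products over \<open>G\<close> are therefore reindexed by right multiplication.\<close>

lemma act_mult:
  assumes "g \<in> carrier G" "h \<in> carrier G"
  shows "act (g \<otimes> h) f = act h (act g f)"
proof -
  have "\<rho> (g \<otimes> h) = ratmap_comp (\<rho> g) (\<rho> h)"
    using \<rho> assms by (simp add: rational_action_def mon_def hom_def Bir_def)
  thus ?thesis
    using assms by (simp add: act_def subst_subst(2) \<rho>_alg_indep ratmap_comp_eq_subst)
qed

text \<open>\<open>act \<one>\<close> is idempotent and injective.\<close>

lemma act_one: "act \<one> f = f"
proof -
  have "act \<one> (act \<one> f) = act \<one> f" by (simp flip: act_mult)
  thus ?thesis using field_hom.eq_iff[OF field_hom_act[OF one_closed]] by blast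
qed

lemma act_distinct:
  assumes "g \<in> carrier G" "h \<in> carrier G" "g \<noteq> h"
  shows "\<exists>f. act g f \<noteq> act h f"
proof (rule ccontr)
  assume "\<nexists>f. act g f \<noteq> act h f"
  hence "\<rho> g $ i = \<rho> h $ i" for i
    using subst_coord[OF \<rho>_alg_indep] assms by (metis act_def)
  hence "\<rho> g = \<rho> h" by (simp add: vec_eq_iff)
  thus False using \<rho> assms by (auto simp: rational_action_def mon_def inj_on_def)
qed

lemma bij_betw_mult_right: "h \<in> carrier G \<Longrightarrow> bij_betw (\<lambda>g. g \<otimes> h) (carrier G) (carrier G)"
  by (rule bij_betw_byWitness[of _ "\<lambda>g. g \<otimes> inv h"]) (auto simp: m_assoc)

text \<open>Equality of \<open>v\<close> after \<open>\<rho> g\<close> with \<open>lam g\<close>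
  after \<open>v\<close>, written through pullbacks so that it makes sense before \<open>v\<close>
  is known to be dominant.\<close>

definition equivariant :: "'k ratmap \<Rightarrow> bool" where
  "equivariant v \<longleftrightarrow> (\<forall>g\<in>carrier G. \<forall>i. act g (v $ i) = (const_mat (lam g) *v v) $ i)"

text \<open>The sum over \<open>G\<close> of \<open>lam (inv g)\<close> applied to the vector
  \<open>(act g u, 0)\<close>, whence the first column.\<close>

definition average :: "'k ratfun \<Rightarrow> 'k ratmap" where
  "average u = (\<chi> i. \<Sum>g\<in>carrier G. const_ratfun (lam (inv g) $ i $ 1) * act g u)"

lemma equivariant_average: "equivariant (average u)"
  unfolding equivariant_def
proof (intro ballI allI)
  fix h i assume h: "h \<in> carrier G"
  interpret act_h: unital_hom "act h" by (rule unital_hom_act[OF h])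
  \<comment> \<open>Since \<open>h \<otimes> inv (g \<otimes> h) = inv g\<close>, shifting
    \<open>g\<close> by \<open>h\<close> recovers the plain sum, while \<open>?F g\<close> itself
    splits off \<open>lam h\<close>.\<close>
  let ?F = "\<lambda>g. const_ratfun (lam (h \<otimes> inv g) $ i $ 1) * act g u"
  have "act h (average u $ i) =
      (\<Sum>g\<in>carrier G. const_ratfun (lam (inv g) $ i $ 1) * act h (act g u))"
    by (simp add: average_def act_h.sum act_h.mult act_const h)
  also have "\<dots> = (\<Sum>g\<in>carrier G. ?F (g \<otimes> h))"
    using h by (intro sum.cong refl) (simp add: act_mult inv_mult_group flip: m_assoc)
  also have "\<dots> = (\<Sum>g\<in>carrier G. ?F g)"
    by (rule sum.reindex_bij_betw[OF bij_betw_mult_right[OF h]])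
  also have "\<dots> = (\<Sum>g\<in>carrier G. const_ratfun (lam h $ i $ 1) * (const_ratfun (lam (inv g) $ 1 $ 1) * act g u)
      + const_ratfun (lam h $ i $ 2) * (const_ratfun (lam (inv g) $ 2 $ 1) * act g u))"
    using h by (intro sum.cong refl)
      (simp add: lam_mult matrix_matrix_mult_def sum_2 const.add const.mult algebra_simps)
  also have "\<dots> = (const_mat (lam h) *v average u) $ i"
    by (simp add: const_mat_vec_nth average_def sum.distrib sum_distrib_left)
  finally show "act h (average u $ i) = (const_mat (lam h) *v average u) $ i" .
qed

text \<open>Otherwise the first components of the averages give a linear relation among the distinct
  \<open>act g\<close>, in which \<open>act \<one>\<close> has coefficient 1.\<close>

lemma ex_equivariant: "\<exists>v. equivariant v \<and> v $ 1 \<noteq> 0"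
proof (rule ccontr)
  assume "\<not> ?thesis"
  hence *: "(\<Sum>g\<in>carrier G. const_ratfun (lam (inv g) $ 1 $ 1) * act g u) = 0" for u
    using equivariant_average[of u] by (auto simp: average_def)
  have "const_ratfun (lam (inv \<one>) $ 1 $ 1) = 0"
    by (rule dedekind_independence[OF fin _ _ act_distinct *])
       (auto intro: unital_hom_act unital_hom.one unital_hom.mult)
  thus False by (simp add: lam_one mat_def const.one)
qed

text \<open>Commutators fix a common left eigenvector and have determinant 1, so they are unipotent; being
  of finite order they are trivial, contradicting that \<open>G\<close> is not Abelian.\<close>

lemma no_common_eigenrow:
  assumes "\<And>g. g \<in> carrier G \<Longrightarrow> \<exists>c. vector [e, 1] v* lam g = c *s vector [e, 1]"
  shows False
proof -
  have comm: "g \<otimes> h = h \<otimes> g" if g: "g \<in> carrier G" and h: "h \<in> carrier G" for g h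
  proof -
    let ?r = "vector [e, 1] :: 'k ^ 2"
    \<comment> \<open>The commutator: \<open>g \<otimes> h\<close> and \<open>h \<otimes> g\<close>
      scale the row by the same factor, so \<open>x\<close> fixes it.\<close>
    define x where "x = g \<otimes> h \<otimes> inv (h \<otimes> g)"
    have x: "x \<in> carrier G" using g h by (simp add: x_def)
    have xhg: "x \<otimes> (h \<otimes> g) = g \<otimes> h" using g h by (simp add: x_def m_assoc)
    obtain c d where c: "?r v* lam g = c *s ?r" and d: "?r v* lam h = d *s ?r"
      using assms g h by blast
    have gh: "?r v* lam (g \<otimes> h) = (c * d) *s ?r" and hg: "?r v* lam (h \<otimes> g) = (c * d) *s ?r"
      using g h c d
      by (simp_all add: lam_mult vector_matrix_mul_assoc[symmetric] scalar_vector_matrix_assoc vector_smult_assoc mult.commute)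
    obtain B where B: "lam (h \<otimes> g) ** B = mat 1"
      using lam_invertible g h unfolding invertible_def by blast
    have "(?r v* lam x) v* lam (h \<otimes> g) = ?r v* lam (h \<otimes> g)"
      using gh hg x g h by (simp add: vector_matrix_mul_assoc xhg flip: lam_mult)
    hence "((?r v* lam x) v* lam (h \<otimes> g)) v* B = (?r v* lam (h \<otimes> g)) v* B" by simp
    hence row: "?r v* lam x = ?r" by (simp add: vector_matrix_mul_assoc B flip: matrix_mul_assoc)
    have "det (lam x) * det (lam (h \<otimes> g)) = det (lam (x \<otimes> (h \<otimes> g)))"
      using g h x by (simp add: lam_mult det_mul)
    also have "\<dots> = det (lam (h \<otimes> g))"
      unfolding xhg using g h by (simp add: lam_mult det_mul mult.commute)
    finally have "det (lam x) * det (lam (h \<otimes> g)) = det (lam (h \<otimes> g))" .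
    moreover have "det (lam (h \<otimes> g)) \<noteq> 0" using lam_invertible g h by (simp add: invertible_det_nz)
    ultimately have "det (lam x) = 1" by simp
    from det_one_fixing_row[OF row this] obtain q where q: "lam x = unipotent e q"
      unfolding unipotent_def by blast
    have "lam (x [^] n) = unipotent e (of_nat n * q)" for n :: nat
    proof (induction n)
      case 0
      thus ?case by (simp add: lam_one unipotent_0)
    next
      case (Suc n)
      thus ?case using x q by (simp add: lam_mult unipotent_mult algebra_simps)
    qed
    \<comment> \<open>Powers of \<open>x\<close> repeat because \<open>G\<close> is finite; in
      characteristic zero this forces \<open>q = 0\<close>.\<close>
    moreover have "\<not> inj (\<lambda>n :: nat. x [^] n)"
      using finite_subset[OF _ fin, of "range (\<lambda>n :: nat. x [^] n)"] x
      by (auto dest: finite_imageD)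
    then obtain m n :: nat where "m \<noteq> n" "x [^] m = x [^] n" by (auto simp: inj_def)
    ultimately have "of_nat m * q = of_nat n * q" by (metis unipotent_eq_iff)
    hence "q = 0" using \<open>m \<noteq> n\<close> by simp
    hence "lam x = lam \<one>" using q by (simp add: lam_one unipotent_0)
    hence "x = \<one>" using lam_inj x by (auto dest: inj_onD)
    thus ?thesis using xhg g h by simp
  qed
  show False using nonabelian group_comm_groupI comm by blast
qed

text \<open>A nontrivial relation has \<open>b \<noteq> 0\<close>, so the constant rows annihilating
  \<open>v\<close> form the line through \<open>(e, 1)\<close>. Applying \<open>G\<close> to the
  relation shows that this line is stable, which gives a common left eigenvector.\<close>

lemma equivariant_lin_indep:
  assumes v: "equivariant v" "v $ 1 \<noteq> 0"
    and rel: "const_ratfun a * v $ 1 + const_ratfun b * v $ 2 = 0"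
  shows "a = 0 \<and> b = 0"
proof (rule ccontr)
  assume ab: "\<not> (a = 0 \<and> b = 0)"
  have "b \<noteq> 0" using ab rel v(2) by (auto simp: const.zero const.eq_0_iff)
  define e where "e = a / b"
  have v2: "v $ 2 = - const_ratfun e * v $ 1"
  proof -
    have "const_ratfun b * v $ 2 = - const_ratfun a * v $ 1"
      using rel by (simp add: eq_neg_iff_add_eq_0 add.commute)
    thus ?thesis using \<open>b \<noteq> 0\<close>
      by (simp add: e_def const.divide const.eq_0_iff field_simps)
  qed
  have "\<exists>c. vector [e, 1] v* lam g = c *s vector [e, 1]" if g: "g \<in> carrier G" for g
  proof -
    let ?A = "lam g"
    have "const_ratfun e * act g (v $ 1) + act g (v $ 2) = 0"
      using g by (simp add: v2 unital_hom.mult[OF unital_hom_act] unital_hom.uminus[OF unital_hom_act] act_const)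
    hence "const_ratfun e * (const_ratfun (?A $ 1 $ 1) * v $ 1 + const_ratfun (?A $ 1 $ 2) * v $ 2)
        + (const_ratfun (?A $ 2 $ 1) * v $ 1 + const_ratfun (?A $ 2 $ 2) * v $ 2) = 0"
      using v(1) g by (simp add: equivariant_def const_mat_vec_nth)
    hence "const_ratfun (e * ?A $ 1 $ 1 + ?A $ 2 $ 1 - (e * ?A $ 1 $ 2 + ?A $ 2 $ 2) * e) * v $ 1 = 0"
      by (simp add: v2 const.add const.diff const.mult algebra_simps)
    hence "e * ?A $ 1 $ 1 + ?A $ 2 $ 1 = (e * ?A $ 1 $ 2 + ?A $ 2 $ 2) * e"
      using v(2) by (simp add: const.eq_0_iff)
    hence "vector [e, 1] v* ?A = (e * ?A $ 1 $ 2 + ?A $ 2 $ 2) *s vector [e, 1]"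
      by (simp add: vector_matrix_mult_def vec_eq_iff forall_2 sum_2 mult.commute)
    thus ?thesis by blast
  qed
  thus False by (rule no_common_eigenrow)
qed

text \<open>Every \<open>f\<close> is a root of the product of the \<open>X - g f\<close>, whose coefficients are invariant.\<close>

lemma derivation_invariants:
  assumes D: "derivation D" and inv: "\<And>a. (\<And>g. g \<in> carrier G \<Longrightarrow> act g a = a) \<Longrightarrow> D a = 0"
  shows "D f = 0"
proof (rule derivation_algebraic[OF D])
  let ?p = "\<Prod>g\<in>carrier G. [:- act g f, 1:]"
  show "?p \<noteq> 0" using fin by simp
  show "poly ?p f = 0"
    using fin by (auto simp: poly_prod act_one intro!: bexI[of _ \<one>])
  fix i
  show "D (coeff ?p i) = 0"
  proof (rule inv)
    fix h assume h: "h \<in> carrier G"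
    interpret act_h: unital_hom "act h" by (rule unital_hom_act[OF h])
    have "map_poly (act h) ?p = (\<Prod>g\<in>carrier G. [:- act (g \<otimes> h) f, 1:])"
      unfolding act_h.map_poly_prod using h
      by (intro prod.cong refl) (simp add: map_poly_pCons act_h.zero act_h.uminus act_h.one act_mult)
    also have "\<dots> = ?p"
      by (rule prod.reindex_bij_betw[OF bij_betw_mult_right[OF h]])
    finally have "coeff (map_poly (act h) ?p) i = coeff ?p i" by simp
    thus "act h (coeff ?p i) = coeff ?p i" by (simp add: coeff_map_poly act_h.zero)
  qed
qed

lemma equivariant_mult:
  assumes "equivariant v" "\<And>g. g \<in> carrier G \<Longrightarrow> act g a = a"
  shows "equivariant (\<chi> i. a * v $ i)"
  using assms
  by (simp add: equivariant_def const_mat_vec_nth unital_hom.mult[OF unital_hom_act] algebra_simps)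

text \<open>Multiplying \<open>v\<close> by an invariant keeps both equivariance and the ratio
  \<open>t\<close>, which leaves the freedom to make the Jacobian nonzero.\<close>

lemma ex_equivariant_jac:
  "\<exists>w. equivariant w \<and> w $ 1 \<noteq> 0 \<and> w $ 2 \<noteq> 0 \<and> jac (w $ 1 / w $ 2) (w $ 2) \<noteq> 0"
proof -
  obtain v where v: "equivariant v" "v $ 1 \<noteq> 0" using ex_equivariant by blast
  have v2: "v $ 2 \<noteq> 0"
    using equivariant_lin_indep[OF v, of 0 1] by (auto simp: const.zero const.one)
  define t where "t = v $ 1 / v $ 2"
  have "\<exists>a. (\<forall>g\<in>carrier G. act g a = a) \<and> jac t (a * v $ 2) \<noteq> 0"
  proof (rule ccontr)
    assume "\<not> ?thesis"
    hence *: "jac t (a * v $ 2) = 0" if "\<And>g. g \<in> carrier G \<Longrightarrow> act g a = a" for a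
      using that by blast
    \<comment> \<open>The case \<open>a = 1\<close>; by the product rule \<open>jac t\<close> then
      kills every invariant.\<close>
    have "jac t (v $ 2) = 0" using *[of 1] unital_hom.one[OF unital_hom_act] by simp
    hence "jac t a = 0" if "\<And>g. g \<in> carrier G \<Longrightarrow> act g a = a" for a
      using *[OF that] v2 by (simp add: jac.mult)
    hence jac0: "jac t f = 0" for f
      by (rule derivation_invariants[OF jac.derivation_axioms])
    have "dx t = 0" "dy t = 0"
      using jac0[of "coord $ 2"] jac0[of "coord $ 1"] by (simp_all add: jac_def)
    then obtain c where "t = const_ratfun c" by (rule const_if_derivs_eq_0)
    hence "const_ratfun (-1) * v $ 1 + const_ratfun c * v $ 2 = 0"
      using v2 by (simp add: t_def field_simps const.uminus const.one)
    thus False using equivariant_lin_indep[OF v] by force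
  qed
  then obtain a where a: "\<And>g. g \<in> carrier G \<Longrightarrow> act g a = a" "jac t (a * v $ 2) \<noteq> 0" by blast
  have "a \<noteq> 0" using a(2) by (auto simp: jac.zero)
  thus ?thesis
    using equivariant_mult[OF v(1) a(1)] v v2 a(2)
    by (intro exI[of _ "\<chi> i. a * v $ i"]) (simp add: t_def)
qed

section \<open>Composition with the equivariant map \<open>m\<close>\<close>

text \<open>For \<open>w = coord\<close> this is the form \<open>h\<close>; in general it is
  \<open>h\<close> evaluated at \<open>w\<close>.\<close>

definition orbit_prod :: "'k ratmap \<Rightarrow> 'k ratfun" where
  "orbit_prod w = (\<Prod>g\<in>carrier G. (const_mat (lam g) *v w) $ 1)"

definition homothety :: "'k ratmap \<Rightarrow> 'k ratmap" where
  "homothety w = (\<chi> i. orbit_prod w * w $ i)"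

text \<open>With \<open>H\<close> the pullback along \<open>w\<close>, this shows that
  \<open>homothety w\<close> is \<open>homothety coord\<close> after \<open>w\<close>.\<close>

lemma hom_homothety:
  assumes "unital_hom H" "\<And>c. H (const_ratfun c) = const_ratfun c"
  shows "H (homothety w $ i) = homothety (\<chi> j. H (w $ j)) $ i"
  using assms
  by (simp add: homothety_def orbit_prod_def unital_hom.mult unital_hom.prod hom_const_mat_vec)

text \<open>Each of the \<open>|G|\<close> linear factors contributes one \<open>z\<close>, and the
  vector itself one more.\<close>

lemma homothety_scale:
  "homothety (\<chi> j. const_ratfun z * w $ j) $ i = const_ratfun (z ^ Suc (card (carrier G))) * homothety w $ i"
proof -
  have "(const_mat A *v (\<chi> j. const_ratfun z * w $ j)) $ 1 = const_ratfun z * (const_mat A *v w) $ 1" for A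
    by (simp add: const_mat_vec_nth algebra_simps)
  moreover have "const_ratfun (z ^ n) = const_ratfun z ^ n" for n
    by (induction n) (simp_all add: const.one const.mult)
  ultimately show ?thesis
    by (simp add: homothety_def orbit_prod_def prod.distrib const.mult algebra_simps)
qed

text \<open>By equivariance the factors of \<open>orbit_prod w\<close> are the translates of
  \<open>w $ 1\<close>, which \<open>G\<close> permutes.\<close>

lemma equivariant_homothety:
  assumes "equivariant w"
  shows "equivariant (homothety w)"
  unfolding homothety_def
proof (rule equivariant_mult[OF assms])
  have *: "orbit_prod w = (\<Prod>g\<in>carrier G. act g (w $ 1))"
    using assms by (simp add: orbit_prod_def equivariant_def)
  fix h assume h: "h \<in> carrier G"
  interpret act_h: unital_hom "act h" by (rule unital_hom_act[OF h])
  have "act h (orbit_prod w) = (\<Prod>g\<in>carrier G. act (g \<otimes> h) (w $ 1))"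
    using h by (simp add: * act_h.prod act_mult)
  also have "\<dots> = orbit_prod w"
    unfolding * by (rule prod.reindex_bij_betw[OF bij_betw_mult_right[OF h]])
  finally show "act h (orbit_prod w) = orbit_prod w" .
qed

text \<open>The ratio of the components is still \<open>t\<close>. The second one is
  \<open>w $ 2 ^ (|G| + 1)\<close> times \<kappa>, a polynomial in \<open>t\<close> that
  \<open>jac t\<close> kills, so its image under \<open>jac t\<close> is nonzero in characteristic
  zero.\<close>

lemma alg_indep_homothety:
  assumes w: "equivariant w" "w $ 1 \<noteq> 0" "w $ 2 \<noteq> 0" "jac (w $ 1 / w $ 2) (w $ 2) \<noteq> 0"
  shows "alg_indep (homothety w)"
proof (rule jacobian_criterion)
  define t where "t = w $ 1 / w $ 2"
  define \<kappa> where "\<kappa> = (\<Prod>g\<in>carrier G. const_ratfun (lam g $ 1 $ 1) * t + const_ratfun (lam g $ 1 $ 2))"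
  have "orbit_prod w = (\<Prod>g\<in>carrier G. w $ 2 * (const_ratfun (lam g $ 1 $ 1) * t + const_ratfun (lam g $ 1 $ 2)))"
    using w(3) by (simp add: orbit_prod_def const_mat_vec_nth t_def algebra_simps)
  hence N: "orbit_prod w = w $ 2 ^ card (carrier G) * \<kappa>" by (simp add: prod.distrib \<kappa>_def)
  \<comment> \<open>Each factor is the image of \<open>w $ 1\<close> under the injective
    \<open>act g\<close>.\<close>
  have "orbit_prod w \<noteq> 0"
    using w(1,2) fin field_hom.eq_0_iff[OF field_hom_act]
    by (simp add: orbit_prod_def flip: bspec[OF w(1)[unfolded equivariant_def], THEN spec])
  hence "\<kappa> \<noteq> 0" using N by simp
  have h2: "homothety w $ 2 = \<kappa> * w $ 2 ^ Suc (card (carrier G))"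
    by (simp add: homothety_def N algebra_simps)
  have h1: "homothety w $ 1 = t * homothety w $ 2"
    using w(3) by (simp add: homothety_def t_def)
  have "jac t \<kappa> = 0"
    unfolding \<kappa>_def by (rule jac.prod_eq_0) (simp add: jac.add jac.mult)
  hence "jac t (homothety w $ 2) = \<kappa> * (of_nat (Suc (card (carrier G))) * w $ 2 ^ card (carrier G) * jac t (w $ 2))"
    by (simp only: h2 jac.mult jac.power_Suc) simp
  hence "jac t (homothety w $ 2) \<noteq> 0"
    using w(3,4) \<open>\<kappa> \<noteq> 0\<close> by (simp add: t_def del: of_nat_Suc)
  moreover have "homothety w $ 2 \<noteq> 0" using h2 w(3) \<open>\<kappa> \<noteq> 0\<close> by simp
  ultimately show "jac (homothety w $ 1) (homothety w $ 2) \<noteq> 0"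
    unfolding h1 jac_times_self by simp
qed

text \<open>Scaling by a \<open>(|G| + 1)\<close>-th root of unity acts trivially on the image of the
  substitution \<open>homothety coord\<close>, which is therefore not all of the function field.\<close>

lemma homothety_not_Bir:
  assumes w: "alg_indep w" and indep: "alg_indep (homothety w)"
  shows "homothety w \<notin> carrier Bir"
proof
  assume Bir: "homothety w \<in> carrier Bir"
  let ?m = "homothety coord"
  note hom_w = field_hom.axioms[OF field_hom_subst[OF w]]
  have sub_m: "(\<chi> i. subst_ratfun w (?m $ i)) = homothety w"
    using hom_homothety[OF hom_w subst_const[OF w]] by (simp add: vec_eq_iff subst_coord[OF w])
  have m: "alg_indep ?m"
    using alg_indep_if_hom[OF hom_w subst_const[OF w]] indep sub_m by metis
  have "card (carrier G) > 0" using fin one_closed by (auto simp: card_gt_0_iff)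
  then obtain z :: 'k where z: "z ^ Suc (card (carrier G)) = 1" "z \<noteq> 1"
    using ex_nontrivial_root_of_unity by blast
  \<comment> \<open>Scalar multiplication by \<open>z\<close> on the plane.\<close>
  define Z where "Z = (\<chi> i. const_ratfun z * coord $ i)"
  have "z \<noteq> 0" using z(1) by auto
  have Z: "alg_indep Z"
    by (rule jacobian_criterion)
       (simp add: Z_def jac_def dx.mult dy.mult const.eq_0_iff \<open>z \<noteq> 0\<close>)
  note hom_Z = field_hom.axioms[OF field_hom_subst[OF Z]]
  have Z_coord: "subst_ratfun Z (coord $ j) = const_ratfun z * coord $ j" for j
    unfolding subst_coord[OF Z] by (simp add: Z_def)
  have "subst_ratfun Z (?m $ i) = ?m $ i" for i
    using hom_homothety[OF hom_Z subst_const[OF Z], of coord i] homothety_scale[of z coord i] z(1)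
    by (simp add: Z_coord const.one)
  hence Zm: "subst_ratfun Z (subst_ratfun ?m f) = subst_ratfun ?m f" for f
    by (simp add: subst_subst(2)[OF Z m])
  \<comment> \<open>Birationality puts \<open>w $ 1\<close> in the image of the pullback along
    \<open>homothety w\<close>; cancelling the injective pullback along \<open>w\<close> puts
    \<open>coord $ 1\<close> in that of \<open>?m\<close>.\<close>
  obtain f where "subst_ratfun (homothety w) f = w $ 1"
    by (rule Bir_subst_surj[OF Bir])
  hence "subst_ratfun w (subst_ratfun ?m f) = subst_ratfun w (coord $ 1)"
    by (simp add: subst_subst(2)[OF w m] sub_m subst_coord[OF w])
  hence "subst_ratfun ?m f = coord $ 1"
    by (simp add: field_hom.eq_iff[OF field_hom_subst[OF w]])
  hence "subst_ratfun Z (coord $ 1) = coord $ 1" using Zm[of f] by simp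
  hence "const_ratfun z * coord $ 1 = coord $ 1" by (simp only: Z_coord)
  hence "dx (const_ratfun z * coord $ 1) = dx (coord $ 1)" by (rule arg_cong)
  hence "const_ratfun z = const_ratfun 1" by (simp add: dx.mult const.one)
  thus False using z(2) by (simp only: const.eq_iff)
qed

lemma nontrivial_base_change: "nontrivial_base_change G \<rho> (\<lambda>g. linear_ratmap (lam g))"
proof -
  obtain w where w: "equivariant w" "w $ 1 \<noteq> 0" "w $ 2 \<noteq> 0" "jac (w $ 1 / w $ 2) (w $ 2) \<noteq> 0"
    using ex_equivariant_jac by blast
  let ?\<tau> = "homothety w"
  have indep: "alg_indep ?\<tau>" by (rule alg_indep_homothety[OF w])
  have "alg_indep w"
    using jacobian_criterion[of w] jac_times_self[of "w $ 1 / w $ 2" "w $ 2"] w(3,4) by simp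
  hence "?\<tau> \<notin> carrier Bir" using indep by (rule homothety_not_Bir)
  \<comment> \<open>Composing with \<open>\<rho> g\<close> first is \<open>act g\<close> on
    components, so this is the equivariance of \<open>?\<tau>\<close>.\<close>
  moreover have "ratmap_comp ?\<tau> (\<rho> g) = ratmap_comp (linear_ratmap (lam g)) ?\<tau>"
    if g: "g \<in> carrier G" for g
    using equivariant_homothety[OF w(1)] g
    by (simp add: ratmap_comp_eq_subst[OF \<rho>_alg_indep[OF g]] ratmap_comp_linear[OF indep]
        vec_eq_iff equivariant_def act_def)
  ultimately show ?thesis
    unfolding nontrivial_base_change_def
    using \<rho> rational_action_linear[OF lam] indep by (auto simp: dominant_iff_alg_indep)
qed

end

theorem theorem2p19:
  fixes G :: "('g, 'm) monoid_scheme"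
    and lam :: "'g \<Rightarrow> 'k::{alg_closed_field, field_char_0} ^ 2 ^ 2"
  assumes "group G"
    and "finite (carrier G)"
    and "\<not> comm_group G"
    and "\<And>n. n \<ge> 1 \<Longrightarrow> \<not> G \<cong> dihedral_group n"
    and "lam \<in> mon G GL2"
  shows "\<forall>\<rho> :: 'g \<Rightarrow> 'k ratmap. rational_action G \<rho> \<longrightarrow>
           nontrivial_base_change G \<rho> (\<lambda>g. linear_ratmap (lam g))"
  using assms by (intro allI impI action_setup.nontrivial_base_change
      action_setup.intro action_setup_axioms.intro)

end
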